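(* Let $n_0,n_1,n_2,n_3,n_4\in\mathbb{Z}_{>0}$ and let $X=[n_0;n_1,n_2,n_3,n_4]=n_0+\cfrac{1}{n_1+\cfrac{1}{n_2+\cfrac{1}{n_3+\cfrac{1}{n_4}}}}$. Then the rational-indexed Fibonacci number $F_X:=\mathrm{F}(X)$ is given by $$\begin{aligned}F_X={}&\Big(\big((F_{n_3-2}F_{n_2-1}+F_{n_3-1}L_{n_2-2})F_{n_1}+(F_{n_3-2}F_{n_2}+F_{n_3-1}L_{n_2-1})L_{n_1-1}\big)L_{n_0}\\&\quad+\big((F_{n_3-2}F_{n_2-1}+F_{n_3-1}L_{n_2-2})F_{n_1-1}+(F_{n_3-2}F_{n_2}+F_{n_3-1}L_{n_2-1})L_{n_1-2}\big)F_{n_0+1}\Big)F_{n_4}\\&+\Big(\big((F_{n_3-3}F_{n_2-1}+F_{n_3-2}L_{n_2-2})F_{n_1}+(F_{n_3-3}F_{n_2}+F_{n_3-2}L_{n_2-1})L_{n_1-1}\big)L_{n_0}\\&\quad+\big((F_{n_3-3}F_{n_2-1}+F_{n_3-2}L_{n_2-2})F_{n_1-1}+(F_{n_3-3}F_{n_2}+F_{n_3-2}L_{n_2-1})L_{n_1-2}\big)F_{n_0+1}\Big)F_{n_4+1}.\end{aligned}$$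
   Context: The conumerator function is the unique map $\mathrm{con}:\mathbb{Q}_{>0}\to\mathbb{Z}_{>0}$ with $\mathrm{con}(1)=1$ and, for all $X\in\mathbb{Q}_{>0}$, $\mathrm{con}(1+X)=\mathrm{con}(X)+\mathrm{con}(1/X)$ and $\mathrm{con}\left(\tfrac{1}{1+X}\right)=\mathrm{con}(X)$. The codenominator function is $\mathrm{F}(X):=\mathrm{con}(1/X)$ for $X\in\mathbb{Q}_{>0}$; equivalently $\mathrm{F}(1)=1$, $\mathrm{F}(1+X)=\mathrm{F}(1/X)$, $\mathrm{F}\left(\tfrac{1}{1+X}\right)=\mathrm{F}(X)+\mathrm{F}(1/X)$. The Fibonacci numbers are $F_0=0$, $F_1=1$, $F_n=F_{n-1}+F_{n-2}$, and the Lucas numbers are $L_0=2$, $L_1=1$, $L_n=L_{n-1}+L_{n-2}$; for negative indices $F_{-n}=(-1)^{n-1}F_n$ and $L_{-n}=(-1)^nL_n$. *)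

theory Defs
  imports "HOL-Library.FuncSet" "HOL-Number_Theory.Fib"
begin

text \<open>
  A map from the positive rationals to the positive integers is represented by a function on
  \<^typ>\<open>rat\<close> that is extensional outside \<open>{0<..}\<close>, so that uniqueness can be stated as an equation
  between functions.
\<close>

definition is_conumerator :: "(rat \<Rightarrow> int) \<Rightarrow> bool" where
  "is_conumerator c \<longleftrightarrow>
     c \<in> {0<..} \<rightarrow>\<^sub>E {0<..} \<and>
     c 1 = 1 \<and>
     (\<forall>X>0. c (1 + X) = c X + c (1 / X)) \<and>
     (\<forall>X>0. c (1 / (1 + X)) = c X)"

definition conumerator :: "rat \<Rightarrow> int" where
  "conumerator = (THE c. is_conumerator c)"

definition codenominator :: "rat \<Rightarrow> int" where
  "codenominator X = conumerator (1 / X)"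

text \<open>
  The description above is proper: \<open>con_frac p q\<close> computes the conumerator of \<open>p / q\<close> by the
  subtractive Euclidean algorithm; the first equation is a junk value.
\<close>

function con_frac :: "nat \<Rightarrow> nat \<Rightarrow> int" where
  "con_frac p q =
     (if p = 0 \<or> q = 0 then 1
      else if p = q then 1
      else if q < p then con_frac (p - q) q + con_frac q (p - q)
      else con_frac (q - p) p)"
  by auto
termination by (relation "measure (\<lambda>(p, q). p + q)") auto

declare con_frac.simps [simp del]

lemma con_frac_pos: "con_frac p q > 0"
proof (induction p q rule: con_frac.induct)
  case (1 p q)
  then show ?case by (subst con_frac.simps) auto
qed

lemma con_frac_one: "con_frac p p = 1"
  by (subst con_frac.simps) simp

lemma con_frac_add:
  assumes "p > 0" "q > 0"
  shows "con_frac (q + p) q = con_frac p q + con_frac q p"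
  using assms by (subst con_frac.simps) simp

lemma con_frac_add':
  assumes "p > 0" "q > 0"
  shows "con_frac q (q + p) = con_frac p q"
  using assms by (subst con_frac.simps) simp

lemma con_frac_cong:
  assumes "p > 0" "q > 0" "p' > 0" "q' > 0" "p * q' = p' * q"
  shows "con_frac p q = con_frac p' q'"
  using assms
proof (induction "p + q" arbitrary: p q p' q' rule: less_induct)
  case less
  have pq: "p * q' = p' * q" and pos: "p > 0" "q > 0" "p' > 0" "q' > 0"
    using less.prems by auto
  consider "p = q" | "q < p" | "p < q" by linarith
  then show ?case
  proof cases
    case 1
    then have "p' = q'" using pq pos by simp
    with 1 show ?thesis by (simp add: con_frac_one)
  next
    case 2
    then obtain a where a: "p = q + a" "a > 0" using less_imp_add_positive by blast
    have "q' < p'"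
    proof (rule ccontr)
      assume "\<not> q' < p'"
      then have "p' * q \<le> q' * q" by simp
      also have "\<dots> < q' * p" using 2 pos by simp
      finally show False using pq by (simp add: mult.commute)
    qed
    then obtain a' where a': "p' = q' + a'" "a' > 0" using less_imp_add_positive by blast
    have eq: "a * q' = a' * q" using pq a a' by (simp add: algebra_simps)
    have "con_frac a q = con_frac a' q'"
      using less.hyps[of a q a' q'] a a' eq pos by simp
    moreover have "con_frac q a = con_frac q' a'"
      using less.hyps[of q a q' a'] a a' eq pos by (simp add: mult.commute)
    ultimately show ?thesis using a a' pos by (simp add: con_frac_add)
  next
    case 3
    then obtain a where a: "q = p + a" "a > 0" using less_imp_add_positive by blast
    have "p' < q'"
    proof (rule ccontr)
      assume "\<not> p' < q'"
      then have "p * q' \<le> p * p'" by simp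
      also have "\<dots> < q * p'" using 3 pos by simp
      finally show False using pq by (simp add: mult.commute)
    qed
    then obtain a' where a': "q' = p' + a'" "a' > 0" using less_imp_add_positive by blast
    have eq: "a * p' = a' * p" using pq a a' by (simp add: algebra_simps)
    have "con_frac a p = con_frac a' p'"
      using less.hyps[of a p a' p'] a a' eq pos by simp
    then show ?thesis using a a' pos by (simp add: con_frac_add')
  qed
qed

lemma pos_rat_cases:
  fixes X :: rat
  assumes "X > 0"
  obtains p q :: nat where "p > 0" "q > 0" "X = of_nat p / of_nat q"
proof -
  obtain a b :: int where ab: "X = Fract a b" "b > 0" by (cases X) auto
  then have a: "a > 0" using assms by (simp add: zero_less_Fract_iff)
  have "X = of_nat (nat a) / of_nat (nat b)" using ab a by (simp add: Fract_of_int_quotient)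
  with a ab show thesis by (intro that[of "nat a" "nat b"]) auto
qed

definition con_rat :: "rat \<Rightarrow> int" where
  "con_rat X =
     (if X > 0 then con_frac (nat (fst (quotient_of X))) (nat (snd (quotient_of X)))
      else undefined)"

lemma con_rat_frac:
  assumes "p > 0" "q > 0"
  shows "con_rat (of_nat p / of_nat q) = con_frac p q"
proof -
  define X :: rat where "X = of_nat p / of_nat q"
  have X: "X > 0" using assms by (simp add: X_def)
  obtain a b where ab: "quotient_of X = (a, b)" by (cases "quotient_of X")
  have b: "b > 0" using quotient_of_denom_pos[OF ab] .
  have Xab: "X = of_int a / of_int b" using quotient_of_div[OF ab] .
  then have a: "a > 0" using X b by (simp add: zero_less_divide_iff)
  have "(of_nat p :: rat) * of_int b = of_int a * of_nat q"
    using Xab b assms unfolding X_def by (simp add: field_simps)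
  then have "(of_int (int p * b) :: rat) = of_int (a * int q)" by simp
  then have "int p * b = a * int q" by (simp only: of_int_eq_iff)
  then have "int (p * nat b) = int (nat a * q)" using a b by simp
  then have "p * nat b = nat a * q" by (simp only: of_nat_eq_iff)
  then have "con_frac p q = con_frac (nat a) (nat b)"
    using a b assms by (intro con_frac_cong) auto
  then show ?thesis using X ab by (simp add: con_rat_def flip: X_def)
qed

lemma is_conumerator_con_rat: "is_conumerator con_rat"
  unfolding is_conumerator_def
proof (intro conjI allI impI)
  show "con_rat \<in> {0<..} \<rightarrow>\<^sub>E {0<..}"
    by (rule PiE_I) (simp_all add: con_rat_def con_frac_pos)
  show "con_rat 1 = 1"
    using con_rat_frac[of 1 1] by (simp add: con_frac_one)
next
  fix X :: rat
  assume "X > 0"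
  then obtain p q :: nat where pq: "p > 0" "q > 0" and X: "X = of_nat p / of_nat q"
    using pos_rat_cases by blast
  have X1: "1 + X = of_nat (q + p) / of_nat q" and X2: "1 / X = of_nat q / of_nat p"
    and X3: "1 / (1 + X) = of_nat q / of_nat (q + p)"
    using pq by (simp_all add: X field_simps)
  show "con_rat (1 + X) = con_rat X + con_rat (1 / X)"
    unfolding X1 X2 unfolding X using pq by (simp add: con_rat_frac con_frac_add del: of_nat_add)
  show "con_rat (1 / (1 + X)) = con_rat X"
    unfolding X3 unfolding X using pq by (simp add: con_rat_frac con_frac_add' del: of_nat_add)
qed

lemma is_conumerator_eq_con_frac:
  assumes c: "is_conumerator c" and "p > 0" "q > 0"
  shows "c (of_nat p / of_nat q) = con_frac p q"
  using assms(2,3)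
proof (induction "p + q" arbitrary: p q rule: less_induct)
  case less
  note pos = less.prems
  have c1: "c 1 = 1"
    using c by (simp add: is_conumerator_def)
  have cadd: "c (1 + X) = c X + c (1 / X)" and cinv: "c (1 / (1 + X)) = c X" if "X > 0" for X
    using c that by (auto simp: is_conumerator_def)
  consider "p = q" | "q < p" | "p < q" by linarith
  then show ?case
  proof cases
    case 1
    then show ?thesis using pos c1 by (simp add: con_frac_one)
  next
    case 2
    then obtain a where a: "p = q + a" "a > 0" using less_imp_add_positive by blast
    have "of_nat p / of_nat q = 1 + (of_nat a / of_nat q :: rat)"
      and "1 / (of_nat a / of_nat q) = (of_nat q / of_nat a :: rat)"
      using pos a by (simp_all add: field_simps)
    then have "c (of_nat p / of_nat q) = c (of_nat a / of_nat q) + c (of_nat q / of_nat a)"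
      using cadd[of "of_nat a / of_nat q"] a pos by simp
    also have "\<dots> = con_frac a q + con_frac q a"
      using less.hyps[of a q] less.hyps[of q a] a pos by simp
    finally show ?thesis using a pos by (simp add: con_frac_add)
  next
    case 3
    then obtain a where a: "q = p + a" "a > 0" using less_imp_add_positive by blast
    have "of_nat p / of_nat q = 1 / (1 + (of_nat a / of_nat p :: rat))"
      using pos a by (simp add: field_simps)
    then have "c (of_nat p / of_nat q) = c (of_nat a / of_nat p)"
      using cinv[of "of_nat a / of_nat p"] a pos by simp
    also have "\<dots> = con_frac a p" using less.hyps[of a p] a pos by simp
    finally show ?thesis using a pos by (simp add: con_frac_add')
  qed
qed

lemma is_conumerator_unique:
  assumes "is_conumerator c" "is_conumerator d"
  shows "c = d"
proof
  fix X :: rat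
  show "c X = d X"
  proof (cases "X > 0")
    case True
    then obtain p q :: nat where "p > 0" "q > 0" "X = of_nat p / of_nat q"
      using pos_rat_cases by blast
    then show ?thesis using assms by (simp add: is_conumerator_eq_con_frac)
  next
    case False
    then show ?thesis using assms
      by (auto simp: is_conumerator_def PiE_def extensional_def)
  qed
qed

theorem ex1_conumerator: "\<exists>!c. is_conumerator c"
  using is_conumerator_con_rat is_conumerator_unique by blast

lemma is_conumerator_conumerator: "is_conumerator conumerator"
  unfolding conumerator_def by (rule theI'[OF ex1_conumerator])

lemma codenominator_1: "codenominator 1 = 1"
  using is_conumerator_conumerator by (simp add: codenominator_def is_conumerator_def)

lemma codenominator_add:
  assumes "X > 0"
  shows "codenominator (1 + X) = codenominator (1 / X)"
  using is_conumerator_conumerator assms by (simp add: codenominator_def is_conumerator_def)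

lemma codenominator_inverse_add:
  assumes "X > 0"
  shows "codenominator (1 / (1 + X)) = codenominator X + codenominator (1 / X)"
  using is_conumerator_conumerator assms by (simp add: codenominator_def is_conumerator_def)

fun lucas :: "nat \<Rightarrow> nat" where
  "lucas 0 = 2"
| "lucas (Suc 0) = 1"
| "lucas (Suc (Suc n)) = lucas (Suc n) + lucas n"

text \<open>Integer-indexed versions, with \<open>F\<^sub>-\<^sub>n = (-1)\<^sup>n\<^sup>-\<^sup>1 F\<^sub>n\<close> and \<open>L\<^sub>-\<^sub>n = (-1)\<^sup>n L\<^sub>n\<close> for \<open>n > 0\<close>.\<close>

definition fib_int :: "int \<Rightarrow> int" where
  "fib_int k =
     (if k \<ge> 0 then int (fib (nat k)) else (-1) ^ (nat (- k) - 1) * int (fib (nat (- k))))"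

definition lucas_int :: "int \<Rightarrow> int" where
  "lucas_int k =
     (if k \<ge> 0 then int (lucas (nat k)) else (-1) ^ nat (- k) * int (lucas (nat (- k))))"

end

(* The pair (F(X), F(1/X)) is transformed linearly by X -> n + X, with Fibonacci numbers as
   coefficients, and is swapped by X -> 1/X. Applying this along the continued fraction writes F(X)
   as a polynomial in the numbers F_{n_i} and F_{n_i - 1}; since L_k = F_{k+1} + F_{k-1} holds for
   all integers k, the claimed formula is the same polynomial. *)

theory Submission
  imports Defs
begin

text \<open>The signs at negative indices are exactly those that let the recurrence run backwards
  through zero.\<close>

lemma fib_int_add_2: "fib_int (k + 2) = fib_int (k + 1) + fib_int k"
proof -
  \<comment> \<open>At \<open>k = - 1\<close> the three indices straddle zero. In the last range
    \<open>k + 2\<close> is still zero for \<open>n = 0\<close>, which is why \<open>n\<close> is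
    split there.\<close>
  consider n where "k = int n" | "k = - 1" | n where "k = - int (Suc (Suc n))"
  proof (cases k rule: int_cases)
    case (neg n)
    with that(2,3) show ?thesis by (cases n) auto
  qed (use that(1) in blast)
  then show ?thesis
  proof cases
    case (1 n)
    then have "nat (k + 2) = Suc (Suc n)" "nat (k + 1) = Suc n" "nat k = n" by auto
    with 1 show ?thesis by (simp add: fib_int_def)
  next
    case 2
    then show ?thesis by (simp add: fib_int_def)
  next
    case (3 n)
    have "nat (- (k + 2)) = n" "nat (- (k + 1)) = Suc n" "nat (- k) = Suc (Suc n)"
      using 3 by auto
    with 3 show ?thesis by (cases n) (auto simp: fib_int_def algebra_simps)
  qed
qed

lemma fib_int_rec: "fib_int k = fib_int (k - 1) + fib_int (k - 2)"
  using fib_int_add_2[of "k - 2"] by simp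

lemma lucas_Suc: "lucas (Suc n) = fib (Suc (Suc n)) + fib n"
  by (induction n rule: lucas.induct) auto

text \<open>Passing from \<open>k\<close> to \<open>- k\<close> swaps the two summands and
  multiplies each by the same sign that \<open>lucas_int\<close> acquires, so everything reduces to
  \<open>lucas_Suc\<close>.\<close>

lemma lucas_int_eq_fib_int: "lucas_int k = fib_int (k + 1) + fib_int (k - 1)"
proof (cases k "0 :: int" rule: linorder_cases)
  case less
  then obtain n where k: "k = - int (Suc n)"
    by (cases k rule: int_cases) auto
  then have "nat (- k) = Suc n" "nat (- (k + 1)) = n" "nat (- (k - 1)) = Suc (Suc n)" by auto
  with k show ?thesis
    by (cases n) (auto simp: fib_int_def lucas_int_def lucas_Suc algebra_simps)
next
  case equal
  then show ?thesis by (simp add: fib_int_def lucas_int_def)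
next
  case greater
  then obtain n where k: "k = int (Suc n)"
    by (metis gr0_implies_Suc zero_less_imp_eq_int)
  then have "nat k = Suc n" "nat (k + 1) = Suc (Suc n)" "nat (k - 1) = n" by auto
  with k show ?thesis by (simp add: fib_int_def lucas_int_def lucas_Suc)
qed

text \<open>Adding 1 sends the pair (F(X), F(1/X)) to (F(1/X), F(X) + F(1/X)). This is the Fibonacci
  matrix, and the coefficients are the entries of its n-th power. The two equations feed each other
  in the induction, hence the joint statement.\<close>

lemma codenominator_int_add:
  fixes n :: int and X :: rat
  assumes "n \<ge> 0" "X > 0"
  shows "codenominator (of_int n + X)
           = fib_int n * codenominator (1 / X) + fib_int (n - 1) * codenominator X"
    and "codenominator (1 / (of_int n + X))
           = fib_int (n + 1) * codenominator (1 / X) + fib_int n * codenominator X"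
proof -
  have "codenominator (of_int n + X)
           = fib_int n * codenominator (1 / X) + fib_int (n - 1) * codenominator X \<and>
        codenominator (1 / (of_int n + X))
           = fib_int (n + 1) * codenominator (1 / X) + fib_int n * codenominator X"
    using assms(1)
  proof (induction n rule: int_ge_induct)
    \<comment> \<open>Here the coefficient \<open>fib_int (- 1)\<close> equals 1, so both equations
      are identities.\<close>
    case base
    show ?case by (simp add: fib_int_def)
  next
    case (step n)
    have pos: "of_int n + X > 0" using step.hyps assms(2) by (simp add: add_nonneg_pos)
    have "of_int (n + 1) + X = 1 + (of_int n + X)" by simp
    then show ?case
      using step.IH codenominator_add[OF pos] codenominator_inverse_add[OF pos]
        fib_int_add_2[of n] fib_int_rec[of "n + 1"]
      by (simp add: algebra_simps)
  qed
  then show "codenominator (of_int n + X)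
           = fib_int n * codenominator (1 / X) + fib_int (n - 1) * codenominator X"
    and "codenominator (1 / (of_int n + X))
           = fib_int (n + 1) * codenominator (1 / X) + fib_int n * codenominator X"
    by simp_all
qed

lemma codenominator_int:
  assumes "n > 0"
  shows "codenominator (of_int n) = fib_int n"
    and "codenominator (1 / of_int n) = fib_int (n + 1)"
  \<comment> \<open>Writing n as (n - 1) + 1 brings in the only known value,
    \<open>codenominator 1 = 1\<close>.\<close>
  using codenominator_int_add[of "n - 1" 1] assms fib_int_rec[of n] fib_int_rec[of "n + 1"]
  by (simp_all add: codenominator_1)

theorem lemma3p4:
  fixes n0 n1 n2 n3 n4 :: int and X :: rat
  assumes "n0 > 0" "n1 > 0" "n2 > 0" "n3 > 0" "n4 > 0"
    and "X = of_int n0 + 1 / (of_int n1 + 1 / (of_int n2 + 1 / (of_int n3 + 1 / of_int n4)))"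
  shows "codenominator X =
     (((fib_int (n3 - 2) * fib_int (n2 - 1) + fib_int (n3 - 1) * lucas_int (n2 - 2)) * fib_int n1
       + (fib_int (n3 - 2) * fib_int n2 + fib_int (n3 - 1) * lucas_int (n2 - 1)) * lucas_int (n1 - 1))
        * lucas_int n0
      + ((fib_int (n3 - 2) * fib_int (n2 - 1) + fib_int (n3 - 1) * lucas_int (n2 - 2)) * fib_int (n1 - 1)
       + (fib_int (n3 - 2) * fib_int n2 + fib_int (n3 - 1) * lucas_int (n2 - 1)) * lucas_int (n1 - 2))
        * fib_int (n0 + 1))
      * fib_int n4
   + (((fib_int (n3 - 3) * fib_int (n2 - 1) + fib_int (n3 - 2) * lucas_int (n2 - 2)) * fib_int n1
       + (fib_int (n3 - 3) * fib_int n2 + fib_int (n3 - 2) * lucas_int (n2 - 1)) * lucas_int (n1 - 1))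
        * lucas_int n0
      + ((fib_int (n3 - 3) * fib_int (n2 - 1) + fib_int (n3 - 2) * lucas_int (n2 - 2)) * fib_int (n1 - 1)
       + (fib_int (n3 - 3) * fib_int n2 + fib_int (n3 - 2) * lucas_int (n2 - 1)) * lucas_int (n1 - 2))
        * fib_int (n0 + 1))
      * fib_int (n4 + 1)"
proof -
  define X3 :: rat where "X3 = of_int n3 + 1 / of_int n4"
  define X2 where "X2 = of_int n2 + 1 / X3"
  define X1 where "X1 = of_int n1 + 1 / X2"
  have pos: "1 / of_int n4 > (0 :: rat)" "1 / X3 > 0" "1 / X2 > 0" "1 / X1 > 0"
    using assms(1-5) by (simp_all add: X1_def X2_def X3_def add_pos_pos)
  have X: "X = of_int n0 + 1 / X1"
    by (simp add: assms(6) X1_def X2_def X3_def)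
  have F4: "codenominator (of_int n4) = fib_int n4"
      "codenominator (1 / of_int n4) = fib_int (n4 + 1)"
    using codenominator_int[OF assms(5)] by simp_all
  \<comment> \<open>From here outwards, each level applies \<open>codenominator_int_add\<close> to
    the reciprocal of the next tail; simplifying the double reciprocal performs the swap.\<close>
  have F3: "codenominator X3 = fib_int n3 * fib_int n4 + fib_int (n3 - 1) * fib_int (n4 + 1)"
      "codenominator (1 / X3) = fib_int (n3 + 1) * fib_int n4 + fib_int n3 * fib_int (n4 + 1)"
    using codenominator_int_add[of n3, OF _ pos(1)] assms(4) by (simp_all add: X3_def F4)
  have F2: "codenominator X2
        = fib_int n2 * codenominator X3 + fib_int (n2 - 1) * codenominator (1 / X3)"
      "codenominator (1 / X2)
        = fib_int (n2 + 1) * codenominator X3 + fib_int n2 * codenominator (1 / X3)"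
    using codenominator_int_add[of n2, OF _ pos(2)] assms(3) by (simp_all add: X2_def)
  have F1: "codenominator X1
        = fib_int n1 * codenominator X2 + fib_int (n1 - 1) * codenominator (1 / X2)"
      "codenominator (1 / X1)
        = fib_int (n1 + 1) * codenominator X2 + fib_int n1 * codenominator (1 / X2)"
    using codenominator_int_add[of n1, OF _ pos(3)] assms(2) by (simp_all add: X1_def)
  have F0: "codenominator X
        = fib_int n0 * codenominator X1 + fib_int (n0 - 1) * codenominator (1 / X1)"
    using codenominator_int_add(1)[of n0, OF _ pos(4)] assms(1) by (simp add: X)
  \<comment> \<open>For each partial quotient everything is expressed through
    \<open>fib_int k\<close> and \<open>fib_int (k - 1)\<close>, which turns the goal into a
    polynomial identity.\<close>
  have fib: "fib_int (k + 1) = fib_int k + fib_int (k - 1)"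
      "fib_int (k - 2) = fib_int k - fib_int (k - 1)"
      "fib_int (k - 3) = 2 * fib_int (k - 1) - fib_int k" for k
    using fib_int_rec[of "k + 1"] fib_int_rec[of k] fib_int_rec[of "k - 1"] by simp_all
  \<comment> \<open>Stated for \<open>n0\<close> alone: with a free index the rule would also
    rewrite terms such as \<open>lucas_int (n1 - 1)\<close>.\<close>
  have lucas0: "lucas_int n0 = fib_int n0 + 2 * fib_int (n0 - 1)"
    using fib(1)[of n0] by (simp add: lucas_int_eq_fib_int)
  have lucas: "lucas_int (k - 1) = 2 * fib_int k - fib_int (k - 1)"
      "lucas_int (k - 2) = 3 * fib_int (k - 1) - fib_int k" for k
    using fib[of k] by (simp_all add: lucas_int_eq_fib_int)
  show ?thesis
    unfolding F0 F1 F2 F3 fib lucas0 lucas by (simp add: algebra_simps)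
qed

end
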